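(* Let $T$ be a densely defined closed operator from $H_1$ to $H_2$ which is one-to-one. Then the following statements are equivalent: (1) $T$ is minimum attaining; (2) the range $R(T)$ is closed and the Moore-Penrose inverse $T^\dagger$ is norm attaining, i.e. $T^\dagger\in\mathcal N(H_2,H_1)$.
   Context: $H_1,H_2$ are infinite dimensional complex Hilbert spaces. A linear operator $T$ with domain $D(T)\subseteq H_1$ and values in $H_2$ is closed if its graph is closed. For a densely defined closed $T$, the minimum modulus is $m(T)=\inf\{\|Tx\|: x\in D(T),\ \|x\|=1\}$, and $T$ is called minimum attaining if there is $x_0\in D(T)$ with $\|x_0\|=1$ and $\|Tx_0\|=m(T)$. A bounded everywhere defined operator $S\in\mathcal B(H_2,H_1)$ is norm attaining (written $S\in\mathcal N(H_2,H_1)$) if there is a unit vector $y_0\in H_2$ with $\|Sy_0\|=\|S\|$. The Moore-Penrose inverse $T^\dagger$ of a densely defined closed $T$ is the unique densely defined closed operator from $H_2$ to $H_1$ with domain $D(T^\dagger)=R(T)\oplus R(T)^\perp$ such that $TT^\dagger y=P_{\overline{R(T)}}\,y$ for all $y\in D(T^\dagger)$, $T^\dagger Tx=P_{N(T)^\perp}\,x$ for all $x\in D(T)$, and $N(T^\dagger)=R(T)^\perp$. Here $N(\cdot)$, $R(\cdot)$ denote null space and range and $P_M$ the orthogonal projection onto the closed subspace $M$. *)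

theory Defs
  imports "HOL-Analysis.Analysis"
begin

section \<open>Complex Hilbert spaces\<close>

class complex_vector = real_vector +
  fixes scaleC :: "complex \<Rightarrow> 'a \<Rightarrow> 'a" (infixr "*\<^sub>C" 75)
  assumes scaleR_scaleC: "r *\<^sub>R x = complex_of_real r *\<^sub>C x"
    and scaleC_add_right: "a *\<^sub>C (x + y) = a *\<^sub>C x + a *\<^sub>C y"
    and scaleC_add_left: "(a + b) *\<^sub>C x = a *\<^sub>C x + b *\<^sub>C x"
    and scaleC_scaleC: "a *\<^sub>C (b *\<^sub>C x) = (a * b) *\<^sub>C x"

text \<open>The inner product is linear in its first argument.  The real inner product of the
  superclass is required to be its real part, so that positive definiteness of \<open>cinner\<close> and
  the fact that the norm is the one induced by \<open>cinner\<close> are inherited from \<open>real_inner\<close>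
  (see \<open>norm_eq_sqrt_cinner\<close> and the lemmas before it).\<close>

class complex_inner = complex_vector + real_inner +
  fixes cinner :: "'a \<Rightarrow> 'a \<Rightarrow> complex"
  assumes cinner_commute: "cinner x y = cnj (cinner y x)"
    and cinner_add_left: "cinner (x + y) z = cinner x z + cinner y z"
    and cinner_scaleC_left: "cinner (a *\<^sub>C x) y = a * cinner x y"
    and inner_cinner: "inner x y = Re (cinner x y)"

class chilbert_space = complex_inner + complete_space

global_interpretation complex_vector:
  vector_space "scaleC :: complex \<Rightarrow> 'a \<Rightarrow> 'a::complex_vector"
  defines cspan = complex_vector.span
    and csubspace = complex_vector.subspace
proof
  show "1 *\<^sub>C x = x" for x :: 'a
    using scaleR_scaleC[of 1 x] by simp
qed (simp_all add: scaleC_add_right scaleC_add_left scaleC_scaleC)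

lemma cinner_self_real: "cinner x x = complex_of_real (inner x x)"
proof -
  have "Im (cinner x x) = - Im (cinner x x)"
    using arg_cong[OF cinner_commute[of x x], of Im] by simp
  then show ?thesis
    by (simp add: complex_eq_iff inner_cinner)
qed

lemma cinner_eq_zero_iff: "cinner x x = 0 \<longleftrightarrow> x = 0"
  by (simp add: cinner_self_real)

lemma norm_eq_sqrt_cinner: "norm x = sqrt (Re (cinner x x))"
  by (simp add: norm_eq_sqrt_inner inner_cinner)

definition orth_compl :: "'a::complex_inner set \<Rightarrow> 'a set" where
  "orth_compl M = {y. \<forall>x\<in>M. cinner y x = 0}"

definition orth_proj :: "'a::complex_inner set \<Rightarrow> 'a \<Rightarrow> 'a" where
  "orth_proj M y = (THE p. p \<in> M \<and> y - p \<in> orth_compl M)"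

section \<open>Unbounded operators\<close>

text \<open>A not necessarily everywhere defined operator is a partial function
  \<open>T :: 'a \<rightharpoonup> 'b\<close>, with domain \<open>dom T\<close>, range \<open>ran T\<close> and value \<open>the (T x)\<close> at
  \<open>x \<in> dom T\<close>.  Hence equality of operators includes equality of their domains,
  and \<open>inj_on T (dom T)\<close> says that \<open>T\<close> is one-to-one.\<close>

definition linear_operator :: "('a::complex_vector \<rightharpoonup> 'b::complex_vector) \<Rightarrow> bool" where
  "linear_operator T \<longleftrightarrow> csubspace (dom T) \<and>
     (\<forall>x\<in>dom T. \<forall>y\<in>dom T. T (x + y) = Some (the (T x) + the (T y))) \<and>
     (\<forall>c. \<forall>x\<in>dom T. T (c *\<^sub>C x) = Some (c *\<^sub>C the (T x)))"

definition densely_defined :: "('a::topological_space \<rightharpoonup> 'b) \<Rightarrow> bool" where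
  "densely_defined T \<longleftrightarrow> closure (dom T) = UNIV"

definition closed_operator :: "('a::chilbert_space \<rightharpoonup> 'b::chilbert_space) \<Rightarrow> bool" where
  "closed_operator T \<longleftrightarrow> linear_operator T \<and> closed (Map.graph T)"

definition null_space :: "('a \<rightharpoonup> 'b::zero) \<Rightarrow> 'a set" where
  "null_space T = {x. T x = Some 0}"

definition min_modulus :: "('a::chilbert_space \<rightharpoonup> 'b::chilbert_space) \<Rightarrow> real" where
  "min_modulus T = Inf {norm (the (T x)) | x. x \<in> dom T \<and> norm x = 1}"

definition minimum_attaining :: "('a::chilbert_space \<rightharpoonup> 'b::chilbert_space) \<Rightarrow> bool" where
  "minimum_attaining T \<longleftrightarrow>
     (\<exists>x0\<in>dom T. norm x0 = 1 \<and> norm (the (T x0)) = min_modulus T)"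

definition bounded_operator :: "('a::chilbert_space \<rightharpoonup> 'b::chilbert_space) \<Rightarrow> bool" where
  "bounded_operator S \<longleftrightarrow>
     linear_operator S \<and> dom S = UNIV \<and> bounded_linear (\<lambda>y. the (S y))"

definition norm_attaining :: "('a::chilbert_space \<rightharpoonup> 'b::chilbert_space) \<Rightarrow> bool" where
  "norm_attaining S \<longleftrightarrow> bounded_operator S \<and>
     (\<exists>y0. norm y0 = 1 \<and> norm (the (S y0)) = onorm (\<lambda>y. the (S y)))"

definition is_moore_penrose ::
  "('a::chilbert_space \<rightharpoonup> 'b::chilbert_space) \<Rightarrow> ('b \<rightharpoonup> 'a) \<Rightarrow> bool" where
  "is_moore_penrose T S \<longleftrightarrow>
     densely_defined S \<and> closed_operator S \<and>
     dom S = {u + v | u v. u \<in> ran T \<and> v \<in> orth_compl (ran T)} \<and>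
     (\<forall>y\<in>dom S. (T \<circ>\<^sub>m S) y = Some (orth_proj (closure (ran T)) y)) \<and>
     (\<forall>x\<in>dom T. (S \<circ>\<^sub>m T) x = Some (orth_proj (orth_compl (null_space T)) x)) \<and>
     null_space S = orth_compl (ran T)"

definition moore_penrose ::
  "('a::chilbert_space \<rightharpoonup> 'b::chilbert_space) \<Rightarrow> ('b \<rightharpoonup> 'a)" where
  "moore_penrose T = (THE S. is_moore_penrose T S)"

lemma is_moore_penrose_unique:
  assumes "is_moore_penrose T S" and "is_moore_penrose T S'"
  shows "S = S'"
proof
  have dom: "dom S = dom S'"
    using assms by (simp add: is_moore_penrose_def)
  have val: "R (u + v) = Some (orth_proj (orth_compl (null_space T)) x)"
    if R: "is_moore_penrose T R" and x: "T x = Some u" and v: "v \<in> orth_compl (ran T)"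
    for R x u v
  proof -
    have Ru: "R u = Some (orth_proj (orth_compl (null_space T)) x)"
      using R x by (force simp: is_moore_penrose_def map_comp_def dom_def)
    have Rv: "R v = Some 0"
      using R v by (auto simp: is_moore_penrose_def null_space_def)
    have "R (u + v) = Some (the (R u) + the (R v))"
      using R Ru Rv domI[of R u] domI[of R v]
      unfolding is_moore_penrose_def closed_operator_def linear_operator_def by blast
    then show ?thesis
      using Ru Rv by simp
  qed
  fix y
  show "S y = S' y"
  proof (cases "y \<in> dom S")
    case True
    then obtain u v where y: "y = u + v" "u \<in> ran T" "v \<in> orth_compl (ran T)"
      using assms(1) by (auto simp: is_moore_penrose_def)
    then obtain x where "T x = Some u"
      by (auto simp: ran_def)
    then show ?thesis
      using val[OF assms(1) _ y(3)] val[OF assms(2) _ y(3)] y(1) by simp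
  next
    case False
    then show ?thesis
      using dom by (metis domIff)
  qed
qed

end

theory Submission
  imports Defs
begin

text \<open>When \<open>R(T)\<close> is closed, \<open>T\<^sup>\<dagger>\<close> is everywhere defined and equals \<open>T\<^sup>-\<^sup>1 \<circ> P\<close>, where \<open>P\<close>
  projects onto \<open>R(T)\<close>; so \<open>m(T)\<close> and \<open>\<parallel>T\<^sup>\<dagger>\<parallel>\<close> are reciprocal, and unit vectors at which one is
  attained are obtained from the other by applying \<open>T\<close> or \<open>T\<^sup>\<dagger>\<close> and rescaling.  Closedness of
  \<open>R(T)\<close> is automatic for a minimum attaining injective \<open>T\<close>: the minimum \<open>m(T) = \<parallel>Tx\<^sub>0\<parallel>\<close> is
  then positive, so \<open>T\<close> is bounded below.\<close>

section \<open>Orthogonal projections\<close>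

lemma csubspace_imp_subspace: "csubspace M \<Longrightarrow> subspace M"
  by (simp add: subspace_def complex_vector.subspace_def scaleR_scaleC)

lemma cinner_scaleC_right: "cinner x (a *\<^sub>C y) = cnj a * cinner x y"
  by (metis cinner_scaleC_left cinner_commute complex_cnj_mult)

lemma csubspace_orth_compl: "csubspace (orth_compl M)"
proof -
  have "cinner 0 x = 0" for x :: 'a
    using cinner_scaleC_left[of 0 0 x] by simp
  then show ?thesis
    by (simp add: complex_vector.subspace_def orth_compl_def cinner_add_left cinner_scaleC_left)
qed

text \<open>Testing against \<open>\<i> *\<^sub>C x\<close>, which stays in \<open>M\<close>,
  recovers the imaginary part of \<open>cinner y x\<close> from a real part. Projection arguments
  can therefore be carried out with the real inner product.\<close>

lemma orth_compl_eq_real: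
  assumes "csubspace M"
  shows "orth_compl M = {y. \<forall>x\<in>M. inner y x = 0}"
proof (intro equalityI subsetI)
  fix y assume y: "y \<in> {y. \<forall>x\<in>M. inner y x = 0}"
  have "cinner y x = 0" if "x \<in> M" for x
  proof -
    have "\<i> *\<^sub>C x \<in> M"
      using assms that by (simp add: complex_vector.subspace_scale)
    then have "Re (cinner y (\<i> *\<^sub>C x)) = 0" "Re (cinner y x) = 0"
      using y that by (auto simp: inner_cinner)
    then show ?thesis
      by (simp add: cinner_scaleC_right complex_eq_iff)
  qed
  then show "y \<in> orth_compl M"
    by (simp add: orth_compl_def)
qed (simp add: orth_compl_def inner_cinner)

text \<open>A minimising sequence for the distance to \<open>M\<close> is Cauchy by the
  parallelogram law; completeness of the space supplies its limit and closedness keeps the limit in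
  \<open>M\<close>.\<close>

lemma exists_closest_point:
  fixes M :: "'a::{real_inner, complete_space} set"
  assumes "closed M" "convex M" "M \<noteq> {}"
  shows "\<exists>p\<in>M. \<forall>q\<in>M. norm (y - p) \<le> norm (y - q)"
proof -
  define d where "d = infdist y M"
  have d_le: "d \<le> norm (y - q)" if "q \<in> M" for q
    using infdist_le[OF that, of y] by (simp add: d_def dist_norm)
  have d0: "d \<ge> 0"
    by (simp add: d_def infdist_nonneg)
  have "\<exists>q\<in>M. norm (y - q) < d + inverse (real (Suc n))" for n
  proof -
    have "(INF q\<in>M. dist y q) < d + inverse (real (Suc n))"
      using assms(3) by (simp add: d_def infdist_notempty)
    then show ?thesis
      using assms(3) by (subst (asm) cINF_less_iff) (auto simp: dist_norm intro: bdd_belowI2[of _ 0])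
  qed
  then obtain f where fM: "\<And>n. f n \<in> M"
    and f: "\<And>n. norm (y - f n) < d + inverse (real (Suc n))"
    by metis
  have lim: "(\<lambda>n. norm (y - f n)) \<longlonglongrightarrow> d"
  proof (rule tendsto_sandwich[OF _ _ tendsto_const])
    show "(\<lambda>n. d + inverse (real (Suc n))) \<longlonglongrightarrow> d"
      using tendsto_add[OF tendsto_const LIMSEQ_inverse_real_of_nat, of d] by simp
    show "\<forall>\<^sub>F n in sequentially. norm (y - f n) \<le> d + inverse (real (Suc n))"
      by (intro always_eventually allI less_imp_le f)
  qed (simp add: d_le fM)
  \<comment> \<open>the parallelogram law, together with the fact that the midpoint lies in \<open>M\<close>\<close>
  have par: "(norm (f m - f n))\<^sup>2 \<le> 2 * (norm (y - f m))\<^sup>2 + 2 * (norm (y - f n))\<^sup>2 - 4 * d\<^sup>2" for m n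
  proof -
    have "(1/2) *\<^sub>R f m + (1/2) *\<^sub>R f n \<in> M"
      using assms(2) fM by (simp add: convex_def)
    then have "d \<le> norm (y - ((1/2) *\<^sub>R f m + (1/2) *\<^sub>R f n))"
      by (rule d_le)
    then have "2 * d \<le> norm (2 *\<^sub>R (y - ((1/2) *\<^sub>R f m + (1/2) *\<^sub>R f n)))"
      by simp
    also have "2 *\<^sub>R (y - ((1/2) *\<^sub>R f m + (1/2) *\<^sub>R f n)) = (y - f m) + (y - f n)"
      by (simp add: scaleR_diff_right scaleR_add_right scaleR_2)
    finally have "2 * d \<le> norm ((y - f m) + (y - f n))" .
    then have "(2 * d)\<^sup>2 \<le> (norm ((y - f m) + (y - f n)))\<^sup>2"
      using d0 by (intro power_mono) auto
    moreover have "(norm ((y - f m) + (y - f n)))\<^sup>2 + (norm (f m - f n))\<^sup>2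
        = 2 * (norm (y - f m))\<^sup>2 + 2 * (norm (y - f n))\<^sup>2"
      by (simp add: power2_norm_eq_inner algebra_simps inner_commute)
    ultimately show ?thesis
      by (simp add: power_mult_distrib)
  qed
  have "Cauchy f"
  proof (rule metric_CauchyI)
    fix e :: real assume e: "e > 0"
    have "(\<lambda>n. (norm (y - f n))\<^sup>2) \<longlonglongrightarrow> d\<^sup>2"
      by (intro tendsto_power lim)
    \<comment> \<open>The margin enters \<open>par\<close> twice with factor 2, so
      \<open>e\<^sup>2 / 4\<close> adds up to exactly \<open>e\<^sup>2\<close> once the terms
      \<open>4 * d\<^sup>2\<close> cancel.\<close>
    moreover have "d\<^sup>2 < d\<^sup>2 + e\<^sup>2 / 4"
      using e by simp
    ultimately have "\<forall>\<^sub>F n in sequentially. (norm (y - f n))\<^sup>2 < d\<^sup>2 + e\<^sup>2 / 4"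
      by (rule order_tendstoD)
    then obtain N where N: "\<And>n. n \<ge> N \<Longrightarrow> (norm (y - f n))\<^sup>2 < d\<^sup>2 + e\<^sup>2 / 4"
      by (auto simp: eventually_sequentially)
    have "dist (f m) (f n) < e" if "m \<ge> N" "n \<ge> N" for m n
    proof -
      have "(norm (f m - f n))\<^sup>2 < e\<^sup>2"
        using par[of m n] N[OF that(1)] N[OF that(2)] by linarith
      then show ?thesis
        using e by (simp add: dist_norm power2_less_imp_less)
    qed
    then show "\<exists>N. \<forall>m\<ge>N. \<forall>n\<ge>N. dist (f m) (f n) < e"
      by blast
  qed
  then obtain p where p: "f \<longlonglongrightarrow> p"
    using Cauchy_convergent convergent_def by blast
  have "p \<in> M"
    using assms(1) fM p by (rule closed_sequentially)
  moreover have "norm (y - p) = d"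
    using lim tendsto_norm[OF tendsto_diff[OF tendsto_const p]] LIMSEQ_unique by blast
  ultimately show ?thesis
    using d_le by auto
qed

text \<open>Take \<open>p\<close> closest to \<open>y\<close>: a nonzero inner product of
  \<open>y - p\<close> with some \<open>x\<close> in \<open>M\<close> would allow a move from
  \<open>p\<close> along \<open>x\<close> to a strictly closer point.\<close>

lemma exists_orthogonal_decomposition:
  fixes M :: "'a::{real_inner, complete_space} set"
  assumes "closed M" "subspace M"
  shows "\<exists>p\<in>M. \<forall>x\<in>M. inner (y - p) x = 0"
proof -
  obtain p where p: "p \<in> M" and min: "\<And>q. q \<in> M \<Longrightarrow> norm (y - p) \<le> norm (y - q)"
    using exists_closest_point[OF assms(1) subspace_imp_convex[OF assms(2)]]
      subspace_0[OF assms(2)] by blast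
  have "inner (y - p) x = 0" if x: "x \<in> M" for x
  proof (cases "x = 0")
    case False
    define a where "a = inner (y - p) x"
    \<comment> \<open>This \<open>t\<close> minimises the quadratic
      \<open>t * t * inner x x - 2 * t * a\<close>, whose minimum is
      \<open>- (a * a / inner x x)\<close>.\<close>
    define t where "t = a / inner x x"
    have "p + t *\<^sub>R x \<in> M"
      using assms(2) p x by (simp add: subspace_add subspace_scale)
    then have "(norm (y - p))\<^sup>2 \<le> (norm (y - (p + t *\<^sub>R x)))\<^sup>2"
      using min by (simp add: power_mono)
    also have "y - (p + t *\<^sub>R x) = (y - p) - t *\<^sub>R x"
      by simp
    also have "(norm ((y - p) - t *\<^sub>R x))\<^sup>2 = (norm (y - p))\<^sup>2 - 2 * t * a + t * t * inner x x"
      unfolding a_def power2_norm_eq_inner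
      by (simp only: inner_diff_left inner_diff_right inner_scaleR_left inner_scaleR_right)
        (simp add: algebra_simps inner_commute)
    also have "t * t * inner x x = t * a"
      using False by (simp add: t_def)
    finally have "a * a / inner x x \<le> 0"
      by (simp add: t_def)
    moreover have "inner x x > 0"
      using False by simp
    ultimately have "a * a \<le> 0"
      by (simp add: divide_le_0_iff)
    then show ?thesis
      by (auto simp: a_def mult_le_0_iff)
  qed simp
  then show ?thesis
    using p by blast
qed

text \<open>Two candidates differ by a vector that lies both in \<open>M\<close> and in its
  orthogonal complement, hence is orthogonal to itself. Values of the definite description are
  computed through this rule.\<close>

lemma orth_proj_eqI:
  assumes M: "csubspace M" and p: "p \<in> M" "y - p \<in> orth_compl M"
  shows "orth_proj M y = p"
  unfolding orth_proj_def
proof (rule the_equality)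
  fix q assume q: "q \<in> M \<and> y - q \<in> orth_compl M"
  have "(y - p) - (y - q) \<in> orth_compl M"
    using p q complex_vector.subspace_diff[OF csubspace_orth_compl] by blast
  then have "q - p \<in> orth_compl M"
    by simp
  moreover have "q - p \<in> M"
    using p q M by (intro complex_vector.subspace_diff) auto
  ultimately have "cinner (q - p) (q - p) = 0"
    by (simp add: orth_compl_def)
  then show "q = p"
    by (simp add: cinner_eq_zero_iff)
qed (use p in blast)

section \<open>Orthogonal projection onto a closed complex subspace\<close>

context
  fixes M :: "'a::chilbert_space set"
  assumes M: "csubspace M" "closed M"
begin

lemma orth_proj_in: "orth_proj M y \<in> M"
  and orth_proj_diff: "y - orth_proj M y \<in> orth_compl M"
proof -
  obtain p where p: "p \<in> M" "y - p \<in> orth_compl M"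
    using exists_orthogonal_decomposition[OF M(2) csubspace_imp_subspace[OF M(1)], of y]
    by (auto simp: orth_compl_eq_real[OF M(1)])
  then have "orth_proj M y = p"
    by (rule orth_proj_eqI[OF M(1)])
  with p show "orth_proj M y \<in> M" "y - orth_proj M y \<in> orth_compl M"
    by simp_all
qed

lemma orth_proj_add: "orth_proj M (x + y) = orth_proj M x + orth_proj M y"
proof (rule orth_proj_eqI[OF M(1)])
  have "(x - orth_proj M x) + (y - orth_proj M y) \<in> orth_compl M"
    by (intro complex_vector.subspace_add csubspace_orth_compl orth_proj_diff)
  then show "x + y - (orth_proj M x + orth_proj M y) \<in> orth_compl M"
    by (simp add: algebra_simps)
qed (intro complex_vector.subspace_add M orth_proj_in)

lemma orth_proj_scaleC: "orth_proj M (c *\<^sub>C y) = c *\<^sub>C orth_proj M y"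
proof (rule orth_proj_eqI[OF M(1)])
  show "c *\<^sub>C y - c *\<^sub>C orth_proj M y \<in> orth_compl M"
    unfolding complex_vector.scale_right_diff_distrib[symmetric]
    by (intro complex_vector.subspace_scale csubspace_orth_compl orth_proj_diff)
qed (intro complex_vector.subspace_scale M orth_proj_in)

lemma norm_orth_proj_le: "norm (orth_proj M y) \<le> norm y"
proof -
  have "orthogonal (orth_proj M y) (y - orth_proj M y)"
    using orth_proj_diff[of y] orth_proj_in[of y]
    by (simp add: orth_compl_eq_real[OF M(1)] orthogonal_def inner_commute)
  then have "(norm y)\<^sup>2 = (norm (orth_proj M y))\<^sup>2 + (norm (y - orth_proj M y))\<^sup>2"
    using norm_add_Pythagorean by fastforce
  then have "(norm (orth_proj M y))\<^sup>2 \<le> (norm y)\<^sup>2"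
    using zero_le_power2[of "norm (y - orth_proj M y)"] by linarith
  then show ?thesis
    by (rule power2_le_imp_le) simp
qed

lemma bounded_linear_orth_proj: "bounded_linear (orth_proj M)"
  by (rule bounded_linear_intro[where K = 1])
    (simp_all add: orth_proj_add orth_proj_scaleC scaleR_scaleC norm_orth_proj_le)

end

section \<open>Operators with closed range\<close>

context
  fixes T :: "'a::complex_vector \<rightharpoonup> 'b::complex_vector"
  assumes T: "linear_operator T"
begin

lemma linear_operator_add: "T x = Some u \<Longrightarrow> T y = Some v \<Longrightarrow> T (x + y) = Some (u + v)"
  using T unfolding linear_operator_def by (metis domI option.sel)

lemma linear_operator_scaleC: "T x = Some u \<Longrightarrow> T (c *\<^sub>C x) = Some (c *\<^sub>C u)"
  using T unfolding linear_operator_def by (metis domI option.sel)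

lemma linear_operator_scaleR: "T x = Some u \<Longrightarrow> T (r *\<^sub>R x) = Some (r *\<^sub>R u)"
  by (simp add: scaleR_scaleC linear_operator_scaleC)

lemma linear_operator_diff: "T x = Some u \<Longrightarrow> T y = Some v \<Longrightarrow> T (x - y) = Some (u - v)"
  using linear_operator_add[OF _ linear_operator_scaleR[of y v "-1"], of x u] by simp

lemma linear_operator_0: "T 0 = Some 0"
proof -
  have "0 \<in> dom T"
    using T by (simp add: linear_operator_def complex_vector.subspace_0)
  then obtain u where "T 0 = Some u"
    by blast
  from linear_operator_scaleR[OF this, of 0] show ?thesis
    by simp
qed

lemma csubspace_ran: "csubspace (ran T)"
  unfolding complex_vector.subspace_def ran_def
  using linear_operator_0 linear_operator_add linear_operator_scaleC by blast

end

text \<open>The lower bound makes the preimages of a convergent sequence in the range Cauchy, and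
  the closed graph then contains the limit of the pairs.\<close>

lemma closed_ran_of_bounded_below:
  assumes T: "closed_operator T" and c: "c > 0"
    and below: "\<And>x u. T x = Some u \<Longrightarrow> c * norm x \<le> norm u"
  shows "closed (ran T)"
  unfolding closed_sequential_limits
proof safe
  fix f y assume "\<forall>n. f n \<in> ran T" and lim: "f \<longlonglongrightarrow> y"
  then obtain g where g: "\<And>n. T (g n) = Some (f n)"
    unfolding ran_def by simp metis
  have lin: "linear_operator T" and cl: "closed (Map.graph T)"
    using T by (auto simp: closed_operator_def)
  have "Cauchy g"
  proof (rule metric_CauchyI)
    fix e :: real assume "e > 0"
    then obtain N where N: "\<And>m n. m \<ge> N \<Longrightarrow> n \<ge> N \<Longrightarrow> dist (f m) (f n) < c * e"
      using LIMSEQ_imp_Cauchy[OF lim] c by (meson metric_CauchyD mult_pos_pos)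
    have "dist (g m) (g n) < e" if "m \<ge> N" "n \<ge> N" for m n
    proof -
      have "c * dist (g m) (g n) < c * e"
        using below[OF linear_operator_diff[OF lin g g], of m n] N[OF that]
        by (simp add: dist_norm)
      then show ?thesis
        using c by simp
    qed
    then show "\<exists>N. \<forall>m\<ge>N. \<forall>n\<ge>N. dist (g m) (g n) < e"
      by blast
  qed
  then obtain x where "g \<longlonglongrightarrow> x"
    using Cauchy_convergent convergent_def by blast
  then have "(\<lambda>n. (g n, f n)) \<longlonglongrightarrow> (x, y)"
    using lim by (rule tendsto_Pair)
  moreover have "(g n, f n) \<in> Map.graph T" for n
    using g by (simp add: Map.graph_def)
  ultimately have "(x, y) \<in> Map.graph T"
    using closed_sequentially[OF cl, of "\<lambda>n. (g n, f n)"] by simp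
  then show "y \<in> ran T"
    by (auto simp: Map.graph_def ran_def)
qed

section \<open>The Moore-Penrose inverse of an injective closed operator with closed range\<close>

context
  fixes T :: "'a::chilbert_space \<rightharpoonup> 'b::chilbert_space"
  assumes T: "closed_operator T" and inj: "inj_on T (dom T)" and closed_ran: "closed (ran T)"
begin

text \<open>The hypothesis says that \<open>S\<close> is the inverse of \<open>T\<close> composed
  with the projection onto \<open>ran T\<close>. It is kept for an arbitrary \<open>S\<close>
  because \<open>moore_penrose T\<close> is a definite description, about which nothing is known
  before a witness exists.\<close>

lemma is_moore_penrose_inverse_orth_proj:
  assumes S: "\<And>y x. S y = Some x \<longleftrightarrow> T x = Some (orth_proj (ran T) y)"
  shows "is_moore_penrose T S"
proof -
  let ?P = "orth_proj (ran T)"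
  have lin: "linear_operator T" and cl: "closed (Map.graph T)"
    using T by (auto simp: closed_operator_def)
  note ran = csubspace_ran[OF lin] closed_ran
  have dom: "dom S = UNIV"
  proof -
    have "\<exists>x. S y = Some x" for y
      using orth_proj_in[OF ran, of y] by (auto simp: S ran_def)
    then show ?thesis
      by auto
  qed
  have val: "T (the (S y)) = Some (?P y)" for y
    using dom S[of y "the (S y)"] by (metis UNIV_I domIff option.collapse)
  have null_T: "null_space T = {0}"
    using linear_operator_0[OF lin] inj
    by (auto simp: null_space_def inj_on_def dom_def)
  \<comment> \<open>By injectivity the projection in the condition on
    \<open>S \<circ>\<^sub>m T\<close> is the identity, so that condition only asks for a left
    inverse.\<close>
  have compl_UNIV: "orth_compl (null_space T) = UNIV"
    unfolding null_T orth_compl_def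
    using cinner_scaleC_right[where a = 0] by (auto simp: complex_eq_iff)
  have P_ran: "?P u = u" if "u \<in> ran T" for u
    using that by (intro orth_proj_eqI ran)
      (simp_all add: complex_vector.subspace_0 csubspace_orth_compl)
  have id: "orth_proj UNIV x = x" for x :: 'a
    by (intro orth_proj_eqI) (simp_all add: complex_vector.subspace_0 csubspace_orth_compl)
  show ?thesis
    unfolding is_moore_penrose_def
  proof (intro conjI ballI)
    show "densely_defined S"
      by (simp add: densely_defined_def dom)
    show "closed_operator S"
      unfolding closed_operator_def
    proof
      show "linear_operator S"
        unfolding linear_operator_def dom
        by (auto simp: S orth_proj_add[OF ran] orth_proj_scaleC[OF ran] complex_vector.subspace_UNIV
            intro!: linear_operator_add[OF lin] linear_operator_scaleC[OF lin] val)
      \<comment> \<open>Closedness of the graph is pulled back from \<open>T\<close> along a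
        continuous map: swap the coordinates and project.\<close>
      have "Map.graph S = (\<lambda>(y, x). (x, ?P y)) -` Map.graph T"
        by (auto simp: Map.graph_def S)
      moreover have "continuous_on UNIV (\<lambda>(y, x :: 'a). (x, ?P y))"
        unfolding case_prod_beta
        by (intro continuous_intros bounded_linear.continuous_on[OF bounded_linear_orth_proj[OF ran]])
      ultimately show "closed (Map.graph S)"
        using cl by (simp add: closed_vimage)
    qed
    show "dom S = {u + v |u v. u \<in> ran T \<and> v \<in> orth_compl (ran T)}"
    proof -
      have "y = ?P y + (y - ?P y)" for y
        by simp
      then show ?thesis
        unfolding dom using orth_proj_in[OF ran] orth_proj_diff[OF ran] by blast
    qed
    show "(T \<circ>\<^sub>m S) y = Some (orth_proj (closure (ran T)) y)" if "y \<in> dom S" for y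
      using val[of y] that closed_ran by (auto simp: map_comp_def)
    show "(S \<circ>\<^sub>m T) x = Some (orth_proj (orth_compl (null_space T)) x)" if "x \<in> dom T" for x
    proof -
      from that obtain u where u: "T x = Some u"
        by blast
      then have "S u = Some x"
        by (simp add: S P_ran ranI)
      then show ?thesis
        using u by (simp add: compl_UNIV id)
    qed
    have "?P y = 0 \<longleftrightarrow> y \<in> orth_compl (ran T)" for y
      using orth_proj_diff[OF ran, of y] orth_proj_eqI[OF ran(1), of 0 y] ran(1)
      by (auto simp: complex_vector.subspace_0)
    then show "null_space S = orth_compl (ran T)"
      by (auto simp: null_space_def S linear_operator_0[OF lin])
  qed
qed

text \<open>The inverse of \<open>T\<close> after the projection is a witness, and uniqueness of
  Moore-Penrose inverses identifies it with the definite description. The remaining facts about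
  \<open>moore_penrose T\<close> rest on this characterisation.\<close>

lemma moore_penrose_eq_Some_iff:
  "moore_penrose T y = Some x \<longleftrightarrow> T x = Some (orth_proj (ran T) y)"
proof -
  define S where "S y = Some (THE x. T x = Some (orth_proj (ran T) y))" for y
  have lin: "linear_operator T"
    using T by (simp add: closed_operator_def)
  have S: "S y = Some x \<longleftrightarrow> T x = Some (orth_proj (ran T) y)" for y x
  proof -
    \<comment> \<open>The inner description is proper: closedness of the range gives existence,
      injectivity gives uniqueness.\<close>
    have "\<exists>x. T x = Some (orth_proj (ran T) y)"
      using orth_proj_in[OF csubspace_ran[OF lin] closed_ran, of y] by (simp add: ran_def)
    moreover have "x = x'" if "T x = Some (orth_proj (ran T) y)" "T x' = Some (orth_proj (ran T) y)"
      for x x'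
      using inj that by (auto simp: inj_on_def dom_def)
    ultimately show ?thesis
      unfolding S_def by (metis (mono_tags, lifting) option.inject the_equality)
  qed
  have "moore_penrose T = S"
    unfolding moore_penrose_def
    using is_moore_penrose_inverse_orth_proj[OF S] is_moore_penrose_unique by blast
  then show ?thesis
    using S by simp
qed

lemma moore_penrose_value: "T (the (moore_penrose T y)) = Some (orth_proj (ran T) y)"
proof -
  have "linear_operator T"
    using T by (simp add: closed_operator_def)
  then have "orth_proj (ran T) y \<in> ran T"
    using closed_ran by (simp add: csubspace_ran orth_proj_in)
  then obtain x where x: "T x = Some (orth_proj (ran T) y)"
    by (auto simp: ran_def)
  then have "moore_penrose T y = Some x"
    by (simp only: moore_penrose_eq_Some_iff)
  with x show ?thesis
    by simp
qed

lemma dom_moore_penrose: "dom (moore_penrose T) = UNIV"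
proof -
  have "moore_penrose T y = Some (the (moore_penrose T y))" for y
    by (simp only: moore_penrose_eq_Some_iff moore_penrose_value)
  then show ?thesis
    by blast
qed

lemma moore_penrose_left_inverse:
  assumes "T x = Some u"
  shows "moore_penrose T u = Some x"
proof -
  have "linear_operator T"
    using T by (simp add: closed_operator_def)
  then have "orth_proj (ran T) u = u"
    using ranI[of T, OF assms]
    by (simp add: orth_proj_eqI csubspace_ran complex_vector.subspace_0 csubspace_orth_compl)
  then show ?thesis
    using assms by (simp add: moore_penrose_eq_Some_iff)
qed

lemma linear_operator_moore_penrose: "linear_operator (moore_penrose T)"
proof -
  have "is_moore_penrose T (moore_penrose T)"
    by (rule is_moore_penrose_inverse_orth_proj) (rule moore_penrose_eq_Some_iff)
  then show ?thesis
    unfolding is_moore_penrose_def closed_operator_def by (elim conjE)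
qed

text \<open>The lower bound is applied to the value of the inverse at \<open>y\<close>, which
  \<open>T\<close> sends to the projection of \<open>y\<close>; the projection does not increase
  norms.\<close>

lemma bounded_linear_moore_penrose:
  assumes c: "c > 0" and below: "\<And>x u. T x = Some u \<Longrightarrow> c * norm x \<le> norm u"
  shows "bounded_linear (\<lambda>y. the (moore_penrose T y))"
    and "norm (the (moore_penrose T y)) \<le> norm y * (1 / c)"
proof -
  let ?S = "moore_penrose T"
  have lin: "linear_operator T"
    using T by (simp add: closed_operator_def)
  show bound: "norm (the (?S y)) \<le> norm y * (1 / c)" for y
  proof -
    have "c * norm (the (?S y)) \<le> norm (orth_proj (ran T) y)"
      by (rule below) (rule moore_penrose_value)
    also have "\<dots> \<le> norm y"
      by (rule norm_orth_proj_le[OF csubspace_ran[OF lin] closed_ran])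
    finally show ?thesis
      using c by (simp add: field_simps)
  qed
  have ex: "?S y = Some (the (?S y))" for y
    using dom_moore_penrose by (metis UNIV_I domIff option.collapse)
  show "bounded_linear (\<lambda>y. the (?S y))"
  proof (rule bounded_linear_intro[OF _ _ bound])
    show "the (?S (x + y)) = the (?S x) + the (?S y)" for x y
      using linear_operator_add[OF linear_operator_moore_penrose ex ex] by simp
    show "the (?S (r *\<^sub>R y)) = r *\<^sub>R the (?S y)" for r y
      using linear_operator_scaleR[OF linear_operator_moore_penrose ex] by simp
  qed
qed

end

section \<open>Minimum modulus and norm of the Moore--Penrose inverse\<close>

text \<open>Normalising \<open>x\<close> extends the infimum over unit vectors to a lower bound on
  the whole domain; the vector 0 is treated apart.\<close>

lemma min_modulus_le:
  assumes T: "linear_operator T" and u: "T x = Some u"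
  shows "min_modulus T * norm x \<le> norm u"
proof (cases "x = 0")
  case False
  have Tx: "T (inverse (norm x) *\<^sub>R x) = Some (inverse (norm x) *\<^sub>R u)"
    using linear_operator_scaleR[OF T u] .
  have "min_modulus T \<le> norm (the (T (inverse (norm x) *\<^sub>R x)))"
    unfolding min_modulus_def
  proof (rule cInf_lower)
    show "norm (the (T (inverse (norm x) *\<^sub>R x))) \<in> {norm (the (T x)) |x. x \<in> dom T \<and> norm x = 1}"
      using Tx False by (force simp: dom_def)
    show "bdd_below {norm (the (T x)) |x. x \<in> dom T \<and> norm x = 1}"
      by (rule bdd_belowI[of _ 0]) auto
  qed
  then show ?thesis
    using Tx False by (simp add: field_simps)
qed simp

lemma min_modulus_eqI:
  assumes "T x0 = Some u0" "norm x0 = 1"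
    and "\<And>x u. T x = Some u \<Longrightarrow> norm x = 1 \<Longrightarrow> norm u0 \<le> norm u"
  shows "min_modulus T = norm u0"
  unfolding min_modulus_def
  by (rule cInf_eq_minimum) (use assms in force)+

lemma norm_attaining_moore_penrose:
  assumes T: "closed_operator T" and inj: "inj_on T (dom T)" and min: "minimum_attaining T"
  shows "closed (ran T)" "norm_attaining (moore_penrose T)"
proof -
  have lin: "linear_operator T"
    using T by (simp add: closed_operator_def)
  obtain x0 u0 where x0: "T x0 = Some u0" "norm x0 = 1" and u0: "norm u0 = min_modulus T"
    using min by (auto simp: minimum_attaining_def)
  define m where "m = min_modulus T"
  \<comment> \<open>Attainment is essential here: an infimum may be 0 for an injective operator, but
    an attained one is the norm of the image of a unit vector.\<close>
  have "u0 \<noteq> 0"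
  proof
    assume "u0 = 0"
    then have "x0 = 0"
      using inj x0(1) linear_operator_0[OF lin] by (auto simp: inj_on_def dom_def)
    then show False
      using x0(2) by simp
  qed
  then have m: "m > 0"
    using u0 by (simp add: m_def flip: zero_less_norm_iff)
  have below: "m * norm x \<le> norm u" if "T x = Some u" for x u
    using min_modulus_le[OF lin that] by (simp add: m_def)
  show cl: "closed (ran T)"
    using T m below by (rule closed_ran_of_bounded_below)
  let ?S = "\<lambda>y. the (moore_penrose T y)"
  note S = bounded_linear_moore_penrose[OF T inj cl m below]
  \<comment> \<open>Since \<open>norm u0 = m\<close>, this is the normalised image of
    \<open>x0\<close>. The inverse sends it to \<open>(1 / m) *\<^sub>R x0\<close>, whose norm meets
    the upper bound \<open>1 / m\<close> on the operator norm.\<close>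
  define y0 where "y0 = (1 / m) *\<^sub>R u0"
  have "moore_penrose T y0 = Some ((1 / m) *\<^sub>R x0)"
    unfolding y0_def by (intro moore_penrose_left_inverse[OF T inj cl] linear_operator_scaleR[OF lin] x0)
  then have y0: "norm y0 = 1" "norm (?S y0) = 1 / m"
    using m x0(2) u0 by (simp_all add: y0_def m_def)
  have "onorm ?S \<le> 1 / m"
    by (rule onorm_bound) (use m S(2) in \<open>auto simp: mult.commute\<close>)
  moreover have "1 / m \<le> onorm ?S"
    using onorm[OF S(1), of y0] y0 by simp
  ultimately show "norm_attaining (moore_penrose T)"
    unfolding norm_attaining_def bounded_operator_def
    using y0 S(1) linear_operator_moore_penrose[OF T inj cl] dom_moore_penrose[OF T inj cl] by auto
qed

text \<open>The bound \<open>s\<close> on the inverse reads as the lower bound \<open>1 / s\<close>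
  on \<open>T\<close>, and the preimage of a norm attaining vector reaches it. The condition
  \<open>dom T \<noteq> {0}\<close> provides unit vectors in the domain and makes \<open>s\<close>
  positive.\<close>

lemma minimum_attaining_of_norm_attaining:
  assumes T: "closed_operator T" and inj: "inj_on T (dom T)" and cl: "closed (ran T)"
    and nonzero: "dom T \<noteq> {0}" and attain: "norm_attaining (moore_penrose T)"
  shows "minimum_attaining T"
proof -
  let ?S = "\<lambda>y. the (moore_penrose T y)"
  let ?P = "orth_proj (ran T)"
  define s where "s = onorm ?S"
  have lin: "linear_operator T"
    using T by (simp add: closed_operator_def)
  obtain y0 where y0: "norm y0 = 1" "norm (?S y0) = s" and bl: "bounded_linear ?S"
    using attain by (auto simp: norm_attaining_def bounded_operator_def s_def)
  \<comment> \<open>The operator norm bound is read at \<open>u\<close>, where the inverse returns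
    \<open>x\<close>.\<close>
  have below: "norm x \<le> s * norm u" if "T x = Some u" for x u
    using onorm[OF bl, of u] moore_penrose_left_inverse[OF T inj cl that] by (simp add: s_def)
  have "s \<noteq> 0"
  proof
    assume "s = 0"
    then have "dom T \<subseteq> {0}"
      using below by fastforce
    then show False
      using nonzero linear_operator_0[OF lin] by blast
  qed
  then have s: "s > 0"
    using y0(2) norm_ge_zero[of "?S y0"] by linarith
  \<comment> \<open>A unit vector because \<open>norm (?S y0) = s\<close>. Its image
    \<open>u0\<close> is a projected unit vector divided by \<open>s\<close>, so its norm is at most
    the lower bound \<open>1 / s\<close>.\<close>
  define x0 where "x0 = (1 / s) *\<^sub>R ?S y0"
  define u0 where "u0 = (1 / s) *\<^sub>R ?P y0"
  have x0: "T x0 = Some u0" "norm x0 = 1"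
    using s y0(2) linear_operator_scaleR[OF lin moore_penrose_value[OF T inj cl]]
    by (simp_all add: x0_def u0_def)
  have "norm u0 \<le> norm u" if "T x = Some u" "norm x = 1" for x u
  proof -
    have "norm (?P y0) \<le> 1"
      using norm_orth_proj_le[OF csubspace_ran[OF lin] cl, of y0] y0(1) by simp
    then have "norm u0 \<le> 1 / s"
      using s by (simp add: u0_def field_simps)
    also have "\<dots> \<le> norm u"
      using below[OF that(1)] that(2) s by (simp add: field_simps)
    finally show ?thesis .
  qed
  then have "min_modulus T = norm u0"
    using x0 by (intro min_modulus_eqI)
  then show ?thesis
    using x0 by (auto simp: minimum_attaining_def dom_def intro!: exI[of _ x0])
qed

theorem theorem3p20:
  fixes T :: "'a::chilbert_space \<rightharpoonup> 'b::chilbert_space"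
  assumes "\<nexists>B :: 'a set. finite B \<and> cspan B = UNIV"
    and "\<nexists>B :: 'b set. finite B \<and> cspan B = UNIV"
    and "densely_defined T"
    and "closed_operator T"
    and "inj_on T (dom T)"
  shows "minimum_attaining T \<longleftrightarrow> closed (ran T) \<and> norm_attaining (moore_penrose T)"
proof -
  \<comment> \<open>If the domain were \<open>{0}\<close>, which is already closed, density would
    make the whole space zero, that is, spanned by the empty set, against infinite
    dimension.\<close>
  have "dom T \<noteq> {0}"
  proof
    assume "dom T = {0}"
    then have "cspan {} = (UNIV :: 'a set)"
      using assms(3) by (simp add: densely_defined_def)
    then show False
      using assms(1) by blast
  qed
  then show ?thesis
    using norm_attaining_moore_penrose minimum_attaining_of_norm_attaining assms(4,5) by blast
qed

end
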